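(* Let $d,n\in\mathbb{N}$ (positive integers) with $n\geq d+1$, and let $P_{n,d}$ be the generalized path graph. Then $$\mathrm{diam}(P_{n,d})=\Big\lceil\frac{n-1}{d}\Big\rceil.$$
   Context: For $n\ge d+1$, the generalized path graph $P_{n,d}$ is the simple undirected graph with vertex set $V(P_{n,d})=[n]=\{1,\dots,n\}$ and edge set $E(P_{n,d})=\{\{i,j\} : |i-j|\in\{1,\dots,d\}\}$. The diameter $\mathrm{diam}(G)$ of a connected graph is the maximum over pairs of vertices of the distance between them, i.e. the length (number of edges) of a shortest path joining them. *)

theory Defs
  imports Complex_Main "HOL-Library.Extended_Nat" "Graph_Theory.Graph_Theory"
begin

(* Finite simple graphs are the pair_graphs of Graph_Theory: irreflexive symmetric arc relations,
   with an undirected edge {i, j} represented by the two arcs (i, j) and (j, i). *)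

definition gen_path :: "nat \<Rightarrow> nat \<Rightarrow> nat pair_pre_digraph" where
  "gen_path n d =
     \<lparr> pverts = {1..n},
       parcs = {(i, j). i \<in> {1..n} \<and> j \<in> {1..n} \<and> \<bar>int i - int j\<bar> \<in> {1..int d}} \<rparr>"

(* The infimum of the empty set is \<infinity>, so vertices in different components are at
   distance \<infinity>; a nonempty infimum in enat is attained. *)
definition graph_dist :: "('a, 'b) pre_digraph \<Rightarrow> 'a \<Rightarrow> 'a \<Rightarrow> enat" where
  "graph_dist G u v = (INF p \<in> {p. pre_digraph.apath G u p v}. enat (length p))"

(* For finite nonempty G the supremum is a maximum; it is \<infinity> if G is not (strongly) connected. *)
definition graph_diameter :: "('a, 'b) pre_digraph \<Rightarrow> enat" where
  "graph_diameter G = (SUP (u, v) \<in> verts G \<times> verts G. graph_dist G u v)"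

lemma pair_graph_gen_path: "pair_graph (gen_path n d)"
proof
  show "finite (parcs (gen_path n d))"
    by (rule finite_subset[of _ "{1..n} \<times> {1..n}"]) (auto simp: gen_path_def)
  show "symmetric (with_proj (gen_path n d))"
    by (auto simp: symmetric_def gen_path_def intro!: symI)
qed (auto simp: gen_path_def)

lemma graph_diameter_eq_Max:
  assumes "finite (verts G)" "verts G \<noteq> {}"
  shows "graph_diameter G = Max ((\<lambda>(u, v). graph_dist G u v) ` (verts G \<times> verts G))"
  using assms by (simp add: graph_diameter_def Sup_enat_def)

lemma graph_dist_attained:
  assumes "pre_digraph.apath G u p v"
  shows "\<exists>q. pre_digraph.apath G u q v \<and> graph_dist G u v = enat (length q)"
proof -
  let ?A = "(\<lambda>p. enat (length p)) ` {p. pre_digraph.apath G u p v}"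
  have "Inf ?A \<in> ?A"
    using assms by (intro wellorder_InfI[of "enat (length p)"]) auto
  then show ?thesis
    by (auto simp: graph_dist_def)
qed

end

theory Submission
  imports Defs
begin

text \<open>
  An edge changes the label of a vertex by at most \<open>d\<close>, so a walk with \<open>k\<close> arcs covers a
  difference of labels of at most \<open>d * k\<close>. Conversely every difference up to \<open>d * k\<close> is
  covered within \<open>k\<close> arcs by the greedy walk that moves \<open>d\<close> places towards its target until
  one last arc reaches it; it never leaves \<open>[n]\<close> since it stays between its end points. Hence
  \<open>u\<close> and \<open>v\<close> are at distance at most \<open>k\<close> iff \<open>\<bar>u - v\<bar> \<le> d * k\<close>
  (\<open>graph_dist_gen_path_le_iff\<close>). The difference is largest for the end points \<open>1\<close> and
  \<open>n\<close>, so the diameter is at most \<open>k\<close> iff \<open>n - 1 \<le> d * k\<close>, that is, iff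
  \<open>\<lceil>(n - 1) / d\<rceil> \<le> k\<close>. An extended natural number is determined by its finite upper
  bounds.

  Distance is an infimum over paths, while the argument composes walks. The two agree because
  deleting cycles turns a walk into a path that is no longer (\<open>graph_dist_le_iff\<close>).
\<close>

lemma (in wf_digraph) length_awalk_to_apath_le:
  assumes "awalk u p v"
  shows "length (awalk_to_apath p) \<le> length p"
  using assms
proof (induct rule: awalk_to_apath_induct)
  case (path p)
  then have "awalk_to_apath p = p"
    by (auto simp: awalk_to_apath.simps)
  then show ?case by simp
next
  case (decomp p q r s)
  have "p = q @ r @ s"
    using awalk_cyc_decomp_has_prop[OF decomp(1,3)] decomp(2) by simp
  then show ?case
    using step_awalk_to_apath[OF decomp(1-3)] decomp(4) by simp
qed

lemma (in wf_digraph) graph_dist_le_iff: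
  "graph_dist G u v \<le> enat k \<longleftrightarrow> (\<exists>p. awalk u p v \<and> length p \<le> k)"
proof
  assume le: "graph_dist G u v \<le> enat k"
  \<comment> \<open>Without a path the distance would be the infimum of the empty set, which is \<open>\<infinity>\<close>.\<close>
  then have "{p. apath u p v} \<noteq> {}"
    by (auto simp: graph_dist_def top_enat_def simp del: Collect_empty_eq)
  then obtain q where "apath u q v" "graph_dist G u v = enat (length q)"
    using graph_dist_attained by fastforce
  with le show "\<exists>p. awalk u p v \<and> length p \<le> k"
    by (auto intro: awalkI_apath)
next
  assume "\<exists>p. awalk u p v \<and> length p \<le> k"
  then obtain p where p: "awalk u p v" "length p \<le> k" by blast
  have "graph_dist G u v \<le> enat (length (awalk_to_apath p))"
    unfolding graph_dist_def using apath_awalk_to_apath[OF p(1)] by (intro INF_lower) simp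
  also have "\<dots> \<le> enat k"
    using length_awalk_to_apath_le[OF p(1)] p(2) by simp
  finally show "graph_dist G u v \<le> enat k" .
qed

lemma gen_path_awalk_label_diff_le:
  assumes "pre_digraph.awalk (gen_path n d) u p v"
  shows "\<bar>int u - int v\<bar> \<le> int d * int (length p)"
proof -
  interpret pair_graph "gen_path n d" by (rule pair_graph_gen_path)
  show ?thesis
    using assms
  proof (induction p arbitrary: u)
    case Nil
    then show ?case by (simp add: awalk_Nil_iff)
  next
    case (Cons e p)
    obtain w where w: "e = (u, w)" "(u, w) \<in> parcs (gen_path n d)" "awalk w p v"
      using Cons.prems by (cases e) (auto simp: awalk_Cons_iff)
    have "\<bar>int u - int w\<bar> \<le> int d"
      using w(2) by (simp add: gen_path_def)
    with Cons.IH[OF w(3)] show ?case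
      by (simp add: algebra_simps)
  qed
qed

text \<open>
  The bound \<open>length p \<le> k\<close> cannot be sharpened to an equation, since the graph has no loops
  with which to pad a walk that arrives early.
\<close>

lemma gen_path_ex_awalk:
  assumes "u \<in> {1..n}" "v \<in> {1..n}" "\<bar>int u - int v\<bar> \<le> int d * int k"
  shows "\<exists>p. pre_digraph.awalk (gen_path n d) u p v \<and> length p \<le> k"
proof -
  interpret pair_graph "gen_path n d" by (rule pair_graph_gen_path)
  show ?thesis
    using assms
  proof (induction k arbitrary: u)
    case 0
    then have "u = v" "u \<in> pverts (gen_path n d)" by (simp_all add: gen_path_def)
    then have "awalk u [] v" by (simp add: awalk_Nil_iff)
    then show ?case by auto
  next
    case (Suc k)
    \<comment> \<open>The greedy step from \<open>u\<close>: \<open>d\<close> places towards \<open>v\<close>, or straight to \<open>v\<close> if it is near.\<close>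
    define w where "w = (if u + d < v then u + d else if v + d < u then u - d else v)"
    have w: "w \<in> {1..n}" "\<bar>int u - int w\<bar> \<le> int d" "\<bar>int w - int v\<bar> \<le> int d * int k"
      using Suc.prems by (auto simp: w_def algebra_simps)
    from Suc.IH[OF w(1) Suc.prems(2) w(3)]
    obtain p where p: "awalk w p v" "length p \<le> k" by blast
    show ?case
    proof (cases "w = u")
      case True
      with p show ?thesis by (metis le_SucI)
    next
      case False
      with w Suc.prems have "(u, w) \<in> parcs (gen_path n d)"
        by (auto simp: gen_path_def)
      with p have "awalk u ((u, w) # p) v" by (simp add: awalk_Cons_iff)
      with p(2) show ?thesis by (metis Suc_le_mono length_Cons)
    qed
  qed
qed

lemma graph_dist_gen_path_le_iff:
  assumes "u \<in> {1..n}" "v \<in> {1..n}"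
  shows "graph_dist (gen_path n d) u v \<le> enat k \<longleftrightarrow> \<bar>int u - int v\<bar> \<le> int d * int k"
proof -
  interpret pair_graph "gen_path n d" by (rule pair_graph_gen_path)
  have "\<bar>int u - int v\<bar> \<le> int d * int k" if "awalk u p v" "length p \<le> k" for p
  proof -
    have "\<bar>int u - int v\<bar> \<le> int d * int (length p)"
      using that(1) by (rule gen_path_awalk_label_diff_le)
    also have "\<dots> \<le> int d * int k"
      using that(2) by (simp add: mult_left_mono)
    finally show ?thesis .
  qed
  then show ?thesis
    unfolding graph_dist_le_iff using gen_path_ex_awalk[OF assms] by blast
qed

lemma graph_diameter_gen_path_le_iff:
  assumes "n \<ge> 1"
  shows "graph_diameter (gen_path n d) \<le> enat k \<longleftrightarrow> n - 1 \<le> d * k"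
proof -
  have "graph_diameter (gen_path n d) \<le> enat k \<longleftrightarrow>
      (\<forall>u\<in>{1..n}. \<forall>v\<in>{1..n}. graph_dist (gen_path n d) u v \<le> enat k)"
    by (auto simp: graph_diameter_def SUP_le_iff gen_path_def)
  also have "\<dots> \<longleftrightarrow> (\<forall>u\<in>{1..n}. \<forall>v\<in>{1..n}. \<bar>int u - int v\<bar> \<le> int (d * k))"
    by (simp add: graph_dist_gen_path_le_iff)
  also have "\<dots> \<longleftrightarrow> n - 1 \<le> d * k"
  proof
    assume "\<forall>u\<in>{1..n}. \<forall>v\<in>{1..n}. \<bar>int u - int v\<bar> \<le> int (d * k)"
    then have "\<bar>int 1 - int n\<bar> \<le> int (d * k)"
      using assms by (meson atLeastAtMost_iff order_refl)
    then show "n - 1 \<le> d * k" by linarith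
  next
    assume "n - 1 \<le> d * k"
    then have "int n - 1 \<le> int (d * k)" by linarith
    then show "\<forall>u\<in>{1..n}. \<forall>v\<in>{1..n}. \<bar>int u - int v\<bar> \<le> int (d * k)"
      by (auto simp del: of_nat_mult)
  qed
  finally show ?thesis .
qed

theorem proposition8:
  fixes d n :: nat
  assumes "d \<ge> 1" and "n \<ge> 1" and "n \<ge> d + 1"
  shows "graph_diameter (gen_path n d) = enat (nat \<lceil>(real n - 1) / real d\<rceil>)"
proof -
  let ?D = "graph_diameter (gen_path n d)" and ?K = "nat \<lceil>(real n - 1) / real d\<rceil>"
  have le_iff: "?D \<le> enat k \<longleftrightarrow> ?K \<le> k" for k
  proof -
    have "?K \<le> k \<longleftrightarrow> (real n - 1) / real d \<le> real k"
      by (simp add: nat_le_iff ceiling_le_iff)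
    also have "\<dots> \<longleftrightarrow> real (n - 1) \<le> real (d * k)"
      using assms by (simp add: field_simps of_nat_diff)
    also have "\<dots> \<longleftrightarrow> n - 1 \<le> d * k"
      by (rule of_nat_le_iff)
    finally show ?thesis
      using graph_diameter_gen_path_le_iff[OF assms(2)] by simp
  qed
  have "?D \<le> enat ?K" by (rule le_iff[THEN iffD2, OF order_refl])
  then obtain m where m: "?D = enat m" by (cases ?D) auto
  with le_iff[of m] \<open>?D \<le> enat ?K\<close> have "m = ?K"
    by (metis enat_ord_simps(1) order_antisym order_refl)
  with m show ?thesis by simp
qed

end
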